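(* Whenever all the series concerned are either convergent or terminating, $$\sum_{m,n=0}^\infty\frac{(1/2,m+n)(-1)^m x^{m+n}2^{-2m-2n}}{(1/2,m)(1/2,n)\,m!\,n!}H_{2m}(y^{1/2})\,H_{2n}(y^{1/2})=\cos(2xy).$$
   Context: Here $x,y$ are complex variables. $(\alpha,n)=\alpha(\alpha+1)\cdots(\alpha+n-1)$ for $n\ge1$ and $(\alpha,0)=1$ (Pochhammer symbol). $H_n$ is the Hermite polynomial in the standard normalization $\sum_{n\ge0}H_n(z)t^n/n!=e^{2zt-t^2}$. *)

theory Defs
  imports "HOL-Complex_Analysis.Complex_Analysis"
begin

text \<open>Hermite polynomials (physicists' normalization), read off as the Taylor coefficients
  in \<open>t\<close> of their generating function.\<close>

definition hermite :: "nat \<Rightarrow> complex \<Rightarrow> complex" where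
  "hermite n z = (deriv ^^ n) (\<lambda>t. exp (2 * z * t - t ^ 2)) 0"

lemma hermite_generating_function:
  "(\<lambda>n. hermite n z * t ^ n / fact n) sums exp (2 * z * t - t ^ 2)"
proof -
  have "(\<lambda>t. exp (2 * z * t - t ^ 2)) holomorphic_on ball 0 (norm t + 1)"
    by (intro holomorphic_intros)
  moreover have "t \<in> ball 0 (norm t + 1)"
    by simp
  ultimately have "(\<lambda>n. (deriv ^^ n) (\<lambda>t. exp (2 * z * t - t ^ 2)) 0 / fact n * (t - 0) ^ n)
      sums exp (2 * z * t - t ^ 2)"
    by (rule holomorphic_power_series)
  then show ?thesis
    by (simp add: hermite_def field_simps)
qed

definition hermite_series_term :: "complex \<Rightarrow> complex \<Rightarrow> nat \<Rightarrow> nat \<Rightarrow> complex" where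
  "hermite_series_term x y m n =
     pochhammer (1/2) (m + n) * (- 1) ^ m * x ^ (m + n) * 2 powi (- 2 * int m - 2 * int n)
       / (pochhammer (1/2) m * pochhammer (1/2) n * fact m * fact n)
     * hermite (2 * m) (csqrt y) * hermite (2 * n) (csqrt y)"

end

(* Write h m = H_{2m}(z) / (2m)! with z^2 = y. Since (2m)! = 4^m (1/2)_m m!, the (m, n) term of the
   series is (-1)^m h m * h n * (1/2)_{m+n} x^{m+n}, so only the antidiagonal sums of
   (-1)^m h m * h n matter. The generating function of h in s = t^2 is exp (-s) cosh (2 z t), and
   that of (-1)^m h m is exp s cosh (2 i z t); in their product the factors exp (-s) and exp s cancel,
   leaving (cosh (2 (1 + i) z t) + cosh (2 (1 - i) z t)) / 2, whose coefficients are explicit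
   because (1 + i)^2 = 2 i and (1 - i)^2 = -2 i. *)
theory Submission
  imports Defs
begin

lemma powser_coeff_unique:
  fixes a b :: "nat \<Rightarrow> complex"
  assumes "\<And>s. (\<lambda>n. a n * s ^ n) sums f s" "\<And>s. (\<lambda>n. b n * s ^ n) sums f s"
  shows "a = b"
proof -
  have "f has_fps_expansion Abs_fps a" "f has_fps_expansion Abs_fps b"
    using assms by (auto intro!: has_fps_expansionI)
  then have "Abs_fps a = Abs_fps b"
    by (rule fps_expansion_unique_complex)
  then show ?thesis
    by (metis fps_nth_Abs_fps ext)
qed

text \<open>Convergence at the real point \<open>norm s + 1\<close>, which lies farther from 0 than
  \<open>s\<close>, forces absolute convergence at \<open>s\<close>. This is what the Cauchy product
  below requires.\<close>

lemma entire_powser_summable_norm: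
  fixes a :: "nat \<Rightarrow> complex"
  assumes "\<And>s. summable (\<lambda>n. a n * s ^ n)"
  shows "summable (\<lambda>n. norm (a n * s ^ n))"
proof (rule powser_insidea[OF assms])
  show "norm s < norm (of_real (norm s + 1) :: complex)"
    by (simp del: of_real_add)
qed

lemma entire_powser_mult_sums:
  fixes a b :: "nat \<Rightarrow> complex"
  assumes a: "\<And>s. (\<lambda>n. a n * s ^ n) sums f s" and b: "\<And>s. (\<lambda>n. b n * s ^ n) sums g s"
  shows "(\<lambda>N. (\<Sum>m\<le>N. a m * b (N - m)) * s ^ N) sums (f s * g s)"
proof -
  have "(\<lambda>N. \<Sum>m\<le>N. (a m * s ^ m) * (b (N - m) * s ^ (N - m)))
      sums ((\<Sum>n. a n * s ^ n) * (\<Sum>n. b n * s ^ n))"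
    by (intro Cauchy_product_sums entire_powser_summable_norm)
       (use a b sums_summable in blast)+
  moreover have "(\<Sum>m\<le>N. (a m * s ^ m) * (b (N - m) * s ^ (N - m)))
      = (\<Sum>m\<le>N. a m * b (N - m)) * s ^ N" for N
  proof -
    have "(a m * s ^ m) * (b (N - m) * s ^ (N - m)) = a m * b (N - m) * s ^ N" if "m \<le> N" for m
    proof -
      have "s ^ N = s ^ m * s ^ (N - m)"
        using that by (simp flip: power_add)
      then show ?thesis
        by simp
    qed
    then show ?thesis
      unfolding sum_distrib_right by (intro sum.cong) auto
  qed
  ultimately show ?thesis
    by (simp add: sums_unique[OF a, symmetric] sums_unique[OF b, symmetric])
qed

text \<open>Averaging over \<open>t\<close> and \<open>- t\<close> kills the odd terms, and the
  surviving even ones form a power series in \<open>t ^ 2\<close>. Putting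
  \<open>t = csqrt s\<close> then gives series in \<open>s\<close>.\<close>

lemma powser_even_part_sums:
  fixes a :: "nat \<Rightarrow> complex"
  assumes "\<And>t. (\<lambda>n. a n * t ^ n) sums f t"
  shows "(\<lambda>n. a (2 * n) * (t ^ 2) ^ n) sums ((f t + f (- t)) / 2)"
proof -
  define c where "c n = (a n * t ^ n + a n * (- t) ^ n) / 2" for n
  have "c sums ((f t + f (- t)) / 2)"
    unfolding c_def by (intro sums_divide sums_add assms)
  moreover have "c n = 0" if "n \<notin> range (\<lambda>k. 2 * k)" for n
  proof -
    have "odd n"
      using that by (auto elim!: evenE)
    then show ?thesis
      by (simp add: c_def)
  qed
  moreover have "strict_mono (\<lambda>k::nat. 2 * k)"
    by (simp add: strict_mono_def)
  ultimately have "(\<lambda>n. c (2 * n)) sums ((f t + f (- t)) / 2)"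
    by (subst sums_mono_reindex)
  then show ?thesis
    by (simp add: c_def power_mult)
qed

lemma exp_sums: "(\<lambda>n. c ^ n / fact n * t ^ n) sums exp (c * t)" for c t :: complex
  using exp_converges[of "c * t"]
  by (simp add: scaleR_conv_of_real field_simps)

text \<open>In the even part of \<open>exp (2 * z * t - t ^ 2)\<close> the factor
  \<open>exp (- t ^ 2)\<close> is common to both halves and the rest averages to a cosh. Here
  \<open>t = csqrt s\<close>, so \<open>t ^ 2 = s\<close> for every complex
  \<open>s\<close>.\<close>

lemma hermite_even_sums:
  "(\<lambda>n. hermite (2 * n) z / fact (2 * n) * s ^ n) sums (exp (- s) * cosh (2 * z * csqrt s))"
proof -
  have "(\<lambda>n. hermite n z / fact n * t ^ n) sums exp (2 * z * t - t ^ 2)" for t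
    using hermite_generating_function[of z t] by simp
  from powser_even_part_sums[OF this, of "csqrt s"] show ?thesis
    by (simp add: cosh_def exp_diff exp_minus scaleR_conv_of_real field_simps)
qed

lemma cosh_csqrt_sums:
  "(\<lambda>n. c ^ (2 * n) / fact (2 * n) * s ^ n) sums cosh (c * csqrt s)"
  using powser_even_part_sums[OF exp_sums, of c "csqrt s"]
  by (simp add: cosh_def scaleR_conv_of_real)

text \<open>The principal roots agree with \<open>csqrt (- s) = \<i> * csqrt s\<close> only up to a
  sign depending on the branch; the evenness of cosh absorbs it.\<close>

lemma cosh_csqrt_uminus: "cosh (c * csqrt (- s)) = cosh (\<i> * c * csqrt s)"
proof -
  have "(csqrt (- s)) ^ 2 = (\<i> * csqrt s) ^ 2"
    by (simp add: power_mult_distrib)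
  then consider "csqrt (- s) = \<i> * csqrt s" | "csqrt (- s) = - (\<i> * csqrt s)"
    by (metis power2_eq_iff)
  then show ?thesis
  proof cases
    case 2
    then have "c * csqrt (- s) = - (\<i> * c * csqrt s)"
      by simp
    then show ?thesis
      by (simp only: cosh_minus)
  qed (simp add: mult_ac)
qed

lemma hermite_even_antidiagonal_sum:
  "(\<Sum>m\<le>N. (- 1) ^ m * (hermite (2 * m) z / fact (2 * m)) *
      (hermite (2 * (N - m)) z / fact (2 * (N - m))))
    = (8 * z ^ 2) ^ N * (\<i> ^ N + (- \<i>) ^ N) / (2 * fact (2 * N))"
proof -
  define h where "h n = hermite (2 * n) z / fact (2 * n)" for n
  let ?p = "(1 + \<i>) * (2 * z)" and ?q = "(1 - \<i>) * (2 * z)"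
  let ?f = "\<lambda>s. (cosh (?p * csqrt s) + cosh (?q * csqrt s)) / 2"
  have h: "(\<lambda>n. h n * s ^ n) sums (exp (- s) * cosh (2 * z * csqrt s))" for s
    unfolding h_def by (rule hermite_even_sums)
  \<comment> \<open>Replacing \<open>s\<close> by \<open>- s\<close> moves the alternating sign into
    the coefficients and turns \<open>exp (- s)\<close> into \<open>exp s\<close>.\<close>
  have "(\<lambda>n. (- 1) ^ n * h n * s ^ n) sums (exp s * cosh (\<i> * (2 * z) * csqrt s))" for s
    using h[of "- s"] unfolding cosh_csqrt_uminus
    by (simp add: power_minus[of s] mult_ac)
  then have "(\<lambda>N. (\<Sum>m\<le>N. (- 1) ^ m * h m * h (N - m)) * s ^ N)
      sums (exp s * cosh (\<i> * (2 * z) * csqrt s) * (exp (- s) * cosh (2 * z * csqrt s)))" for s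
    by (rule entire_powser_mult_sums) (rule h)
  moreover have "exp s * cosh (\<i> * (2 * z) * csqrt s) * (exp (- s) * cosh (2 * z * csqrt s)) = ?f s"
    for s
  proof -
    \<comment> \<open>With \<open>u = 2 * z * csqrt s\<close> and \<open>v = \<i> * u\<close> the
      two arguments are \<open>u + v\<close> and \<open>u - v\<close>; adding the two addition
      formulas cancels the sinh products and leaves \<open>2 * cosh u * cosh v\<close>.\<close>
    have "?p * csqrt s = 2 * z * csqrt s + \<i> * (2 * z) * csqrt s"
      "?q * csqrt s = 2 * z * csqrt s - \<i> * (2 * z) * csqrt s"
      by (simp_all add: algebra_simps)
    then have "?f s = cosh (2 * z * csqrt s) * cosh (\<i> * (2 * z) * csqrt s)"
      by (simp only: cosh_add cosh_diff) simp
    moreover have "exp s * a * (exp (- s) * b) = b * a" for a b :: complex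
    proof -
      have "exp s * a * (exp (- s) * b) = exp s * exp (- s) * (b * a)"
        by (simp only: mult_ac)
      then show ?thesis
        by (simp flip: exp_add)
    qed
    ultimately show ?thesis
      by simp
  qed
  ultimately have "(\<lambda>N. (\<Sum>m\<le>N. (- 1) ^ m * h m * h (N - m)) * s ^ N) sums ?f s" for s
    by simp
  \<comment> \<open>A second expansion of the same function, with explicit coefficients, to be
    compared with the Cauchy product.\<close>
  moreover have "(\<lambda>N. (?p ^ (2 * N) / fact (2 * N) + ?q ^ (2 * N) / fact (2 * N)) / 2 * s ^ N)
      sums ?f s" for s
    using sums_divide[OF sums_add[OF cosh_csqrt_sums[of ?p s] cosh_csqrt_sums[of ?q s]], of 2]
    by (simp only: distrib_right times_divide_eq_left)
  ultimately have "(\<lambda>N. \<Sum>m\<le>N. (- 1) ^ m * h m * h (N - m))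
      = (\<lambda>N. (?p ^ (2 * N) / fact (2 * N) + ?q ^ (2 * N) / fact (2 * N)) / 2)"
    by (rule powser_coeff_unique)
  moreover have "?p ^ 2 = 8 * z ^ 2 * \<i>" "?q ^ 2 = 8 * z ^ 2 * (- \<i>)"
    by (simp_all add: power2_eq_square algebra_simps)
  then have "?p ^ (2 * N) = (8 * z ^ 2) ^ N * \<i> ^ N" "?q ^ (2 * N) = (8 * z ^ 2) ^ N * (- \<i>) ^ N"
    by (simp_all only: power_mult power_mult_distrib)
  ultimately have "(\<Sum>m\<le>N. (- 1) ^ m * h m * h (N - m))
      = ((8 * z ^ 2) ^ N * \<i> ^ N / fact (2 * N) + (8 * z ^ 2) ^ N * (- \<i>) ^ N / fact (2 * N)) / 2"
    by (simp only: fun_eq_iff)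
  then show ?thesis
    unfolding h_def by (simp add: field_simps)
qed

text \<open>By \<open>fact_double\<close>, the Pochhammer symbols, factorials and powers of 2 in the
  denominator combine into \<open>fact (2 * m) * fact (2 * n)\<close>, once the negative integer
  power is rewritten as an inverse of natural powers.\<close>

lemma hermite_series_term_eq:
  "hermite_series_term x y m n =
     pochhammer (1/2) (m + n) * x ^ (m + n) *
     ((- 1) ^ m * (hermite (2 * m) (csqrt y) / fact (2 * m)) * (hermite (2 * n) (csqrt y) / fact (2 * n)))"
proof -
  have "(2::complex) powi (- 2 * int m - 2 * int n) = inverse (2 ^ (2 * m) * 2 ^ (2 * n))"
  proof -
    have "- 2 * int m - 2 * int n = - int (2 * m + 2 * n)"
      by simp
    then show ?thesis
      by (simp only: power_int_minus power_int_of_nat power_add)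
  qed
  then show ?thesis
    unfolding hermite_series_term_def fact_double by (simp add: divide_simps)
qed

lemma hermite_series_term_antidiagonal_sum:
  "(\<Sum>m\<le>N. hermite_series_term x y m (N - m))
    = ((\<i> * (2 * x * y)) ^ N / fact N + (- (\<i> * (2 * x * y))) ^ N / fact N) / 2"
proof -
  have "(\<Sum>m\<le>N. hermite_series_term x y m (N - m)) =
      pochhammer (1/2) N * x ^ N * ((8 * y) ^ N * (\<i> ^ N + (- \<i>) ^ N) / (2 * fact (2 * N)))"
  proof -
    have "hermite_series_term x y m (N - m) = pochhammer (1/2) N * x ^ N *
        ((- 1) ^ m * (hermite (2 * m) (csqrt y) / fact (2 * m)) *
          (hermite (2 * (N - m)) (csqrt y) / fact (2 * (N - m))))" if "m \<le> N" for m
      unfolding hermite_series_term_eq using that by (simp only: le_add_diff_inverse)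
    then have "(\<Sum>m\<le>N. hermite_series_term x y m (N - m)) = pochhammer (1/2) N * x ^ N *
        (\<Sum>m\<le>N. (- 1) ^ m * (hermite (2 * m) (csqrt y) / fact (2 * m)) *
          (hermite (2 * (N - m)) (csqrt y) / fact (2 * (N - m))))"
      unfolding sum_distrib_left by (intro sum.cong) auto
    then show ?thesis
      \<comment> \<open>The closed form involves only the square of the Hermite argument, so the
        root of \<open>y\<close> disappears.\<close>
      by (simp only: hermite_even_antidiagonal_sum power2_csqrt)
  qed
  also have "fact (2 * N) = (4 ^ N * pochhammer (1/2) N * fact N :: complex)"
    unfolding fact_double by (simp add: power_mult)
  \<comment> \<open>The factor \<open>4 ^ N\<close> is split off to cancel the one coming from
    \<open>fact (2 * N)\<close>.\<close>
  also have "(8 * y) ^ N = 4 ^ N * (2 * y) ^ N"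
    unfolding power_mult_distrib[of 4 "2 * y" N, symmetric] by simp
  also have "pochhammer (1/2) N * x ^ N * (4 ^ N * (2 * y) ^ N * (\<i> ^ N + (- \<i>) ^ N) /
        (2 * (4 ^ N * pochhammer (1/2) N * fact N)))
      = (2 * x * y) ^ N * (\<i> ^ N + (- \<i>) ^ N) / (2 * fact N)"
  proof -
    \<comment> \<open>It divides the nonzero number \<open>fact (2 * N)\<close>.\<close>
    have "pochhammer (1/2 :: complex) N \<noteq> 0"
      using fact_double[of N, where 'a = complex] by (metis fact_nonzero mult_eq_0_iff)
    then show ?thesis
      by (simp add: power_mult_distrib)
  qed
  also have "\<dots> = ((\<i> * (2 * x * y)) ^ N / fact N + (- \<i> * (2 * x * y)) ^ N / fact N) / 2"
    unfolding power_mult_distrib[of \<i>] power_mult_distrib[of "- \<i>"]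
    by (simp add: field_simps)
  finally show ?thesis
    by simp
qed

text \<open>Unconditional summability over pairs permits grouping by \<open>m + n\<close> into
  finite blocks without changing the total; uniqueness of limits then identifies it with
  \<open>S\<close>.\<close>

lemma infsum_nat_pairs_eq_antidiagonal_suminf:
  fixes f :: "nat \<Rightarrow> nat \<Rightarrow> complex"
  assumes "(\<lambda>(m, n). f m n) summable_on UNIV" and "(\<lambda>N. \<Sum>m\<le>N. f m (N - m)) sums S"
  shows "(\<Sum>\<^sub>\<infinity>(m, n)\<in>UNIV. f m n) = S"
proof -
  let ?T = "\<Sum>\<^sub>\<infinity>(m, n)\<in>UNIV. f m n"
  have "((\<lambda>(m, n). f m n) has_sum ?T) UNIV"
    using assms(1) by simp
  also have "?this \<longleftrightarrow> ((\<lambda>(N, m). f m (N - m)) has_sum ?T) (SIGMA N:UNIV. {..N})"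
    \<comment> \<open>A pair \<open>(m, n)\<close> is encoded by its antidiagonal
      \<open>m + n\<close> and its position \<open>m\<close> there.\<close>
    by (rule has_sum_reindex_bij_witness[of _ "\<lambda>(N, m). (m, N - m)" "\<lambda>(m, n). (m + n, m)"]) auto
  finally have "((\<lambda>N. \<Sum>m\<le>N. f m (N - m)) has_sum ?T) UNIV"
    by (rule has_sum_SigmaD) (auto intro: has_sum_finiteI)
  then show ?thesis
    using assms(2) has_sum_imp_sums sums_unique2 by blast
qed

theorem mainTheorem11:
  fixes x y :: complex
  assumes "(\<lambda>(m, n). hermite_series_term x y m n) summable_on (UNIV :: (nat \<times> nat) set)"
  shows "(\<Sum>\<^sub>\<infinity>(m, n) \<in> (UNIV :: (nat \<times> nat) set). hermite_series_term x y m n) = cos (2 * x * y)"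
proof (rule infsum_nat_pairs_eq_antidiagonal_suminf[OF assms])
  \<comment> \<open>The antidiagonal sums are averages of the exponential terms at
    \<open>\<i> * (2 * x * y)\<close> and its negative, which is Euler's formula for the
    cosine.\<close>
  have "(\<lambda>N. c ^ N / fact N) sums exp c" for c :: complex
    using exp_sums[of c 1] by simp
  then show "(\<lambda>N. \<Sum>m\<le>N. hermite_series_term x y m (N - m)) sums cos (2 * x * y)"
    unfolding hermite_series_term_antidiagonal_sum cos_exp_eq
    by (intro sums_divide sums_add)
qed

end
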